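(* Let $X=Y\setminus Z\subset\mathbb P^n$ ($n\ge2$) be a (possibly singular) quasi-projective variety, $\mathcal S$ a Whitney stratification of $Y$ with $Z$ a union of strata, $\mathcal L$ a hyperplane transverse to $\mathcal S$, and $\mathcal P$ a pencil of hyperplanes having $\mathcal L$ as a member and whose axis $\mathcal M$ is transverse to $\mathcal S$. Assume $\mathcal M\cap X\ne\emptyset$ and let $*\in\mathcal M\cap X$. Fix an index $i$ of an exceptional hyperplane $\mathcal L_i$ and an integer $q\ge1$. Let $\chi\colon\pi_q(\mathcal L\cap X,\mathcal M\cap X,* )\to H_q(\mathcal L\cap X,\mathcal M\cap X)$ and $\hat\chi\colon\pi_q(\mathcal L\cap X,* )\to H_q(\mathcal L\cap X)$ be the Hurewicz homomorphisms. Then $$\hat\chi\circ\mathrm{VAR}_{i,q}=\mathrm{var}_{i,q}\circ\chi ,$$ where $\mathrm{VAR}_{i,q}\colon\pi_q(\mathcal L\cap X,\mathcal M\cap X,* )\to\pi_q(\mathcal L\cap X,* )$ is the generalized homotopical variation operator and $\mathrm{var}_{i,q}\colon H_q(\mathcal L\cap X,\mathcal M\cap X)\to H_q(\mathcal L\cap X)$ is the homological variation operator.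
   Context: $Y$ is a non-empty closed algebraic subset of $\mathbb P^n$ and $Z$ a proper closed algebraic subset of $Y$. Homology is singular with integer coefficients. All members of $\mathcal P$ are transverse to (all strata of) $\mathcal S$ except finitely many, called exceptional hyperplanes $(\mathcal L_i)_i$ (one may also count finitely many ordinary members different from $\mathcal L$ as exceptional). Parametrize $\mathcal P$ by $\mathbb P^1$ as usual: $\mathcal P(\mu)$ is the member with parameter $\mu$, $\mathcal L=\mathcal P(\lambda)$, $\mathcal L_i=\mathcal P(\lambda_i)$. For $G\subset\mathbb P^n$, $E\subset\mathbb P^1$, put $G_E=\bigcup_{\mu\in E}G\cap\mathcal P(\mu)$. Loops. For each $i$ let $D_i\subset\mathbb P^1$ be a small closed semi-analytic disk with centre $\lambda_i$, the $D_i$ mutually disjoint, $\gamma_i\in\partial D_i$, and $\Gamma_i$ the image of a simple real-analytic arc joining $\lambda$ to $\gamma_i$, with $\Gamma_i\cap D_i=\{\gamma_i\}$, and $\Gamma_i\cap\Gamma_{i'}=\{\lambda\}$, $\Gamma_i\cap D_{i'}=\emptyset$ for $i\neq i'$. Put $K_i=\Gamma_i\cup D_i$. Let $\omega_i$ be the loop in $\partial K_i$ starting at $\lambda$, running along $\Gamma_i$ to $\gamma_i$, once counter-clockwise around $\partial D_i$, and back along $\Gamma_i$ to $\lambda$. Monodromy. For each $i$ there is an isotopy $\Theta\colon(\mathcal L\cap X)\times[0,1]\to X_{\partial K_i}$ with $\Theta(x,0)=x$, $\Theta(x,t)\in X_{\omega_i(t)}$, $x\mapsto\Theta(x,t)$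 a homeomorphism $\mathcal L\cap X\to X_{\omega_i(t)}$ for every $t$, and $\Theta(x,t)=x$ for $x\in\mathcal M\cap X$. The homeomorphism $h=\Theta(\cdot,1)$ of $\mathcal L\cap X$ is called a geometric monodromy of $\mathcal L\cap X$ relative to $\mathcal M\cap X$ above $\omega_i$; it fixes $\mathcal M\cap X$ pointwise. Homological variation. $\mathrm{var}_{i,q}([z])=[h_q(z)-z]$, where $h_q$ is the chain map induced by $h$ and $z$ is a relative $q$-cycle of $\mathcal L\cap X$ modulo $\mathcal M\cap X$; it is a well-defined homomorphism depending only on the homotopy class of $\omega_i$ in $\mathbb P^1\setminus\bigcup_j\{\lambda_j\}$. Generalized homotopical variation. Let $I=[0,1]$. For a pointed pair $(A,B,* )$, $*\in B$, $F^q(A,B,* )$ is the set of maps $I^q\to A$ sending the face $x_q=0$ into $B$ and all other faces to $*$, and $F^q(A,* )$ the set of maps $I^q\to A$ sending $\partial I^q$ to $*$; $\langle f\rangle$ denotes the homotopy class in $\pi_q(A,B,* )$, resp. $\pi_q(A,* )$. For $f\in F^q(\mathcal L\cap X,\mathcal M\cap X,* )$, let $f\bot(h\circ f)\in F^q(\mathcal L\cap X,* )$ be the map equal to $f(x_1,\dots,x_{q-1},1-2x_q)$ if $0\le x_q\le\frac12$ and to $h\circ f(x_1,\dots,x_{q-1},2x_q-1)$ if $\frac12\le x_q\le1$. Then $\mathrm{VAR}_{i,q}(\langle f\rangle)=\langle f\bot(h\circ f)\rangle$ is a well-defined map depending only on the homotopy class of $\omega_i$ in $\mathbb P^1\setminus\bigcup_j\{\lambda_j\}$.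 The Hurewicz maps send $\langle f\rangle$ to the image under $f_*$ of the class of the identity cube in $H_q(I^q,\partial I^q)$ (same generator for both); for $q=1$, $\chi$ is only a map of sets. *)

theory Defs
  imports "HOL-Homology.Homology" "HOL-Complex_Analysis.Complex_Analysis"
begin

section \<open>Complex projective space\<close>

text \<open>A point of the projective space of dimension \<^term>\<open>CARD('n) - 1\<close> is a line through the
  origin of \<^typ>\<open>complex ^ 'n\<close>.\<close>

typedef (overloaded) ('n::finite) cproj =
  "{l :: (complex ^ 'n) set. vec.subspace l \<and> vec.dim l = 1}"
proof -
  fix k :: 'n
  have "axis k (1::complex) \<noteq> 0"
    by (metis axis_nth one_neq_zero zero_index)
  then have "vec.dim (vec.span {axis k (1::complex)}) = 1"
    by (simp only: vec.dim_span vec.dim_singleton if_False)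
  then show ?thesis
    by (intro exI[of _ "vec.span {axis k (1::complex)}"]) (simp only: mem_Collect_eq vec.subspace_span simp_thms)
qed

definition cline :: "complex ^ 'n \<Rightarrow> 'n::finite cproj" where
  "cline v = Abs_cproj (vec.span {v})"

text \<open>The quotient topology of the punctured space \<^term>\<open>UNIV - {0 :: complex ^ 'n}\<close>.\<close>

instantiation cproj :: (finite) topological_space
begin

definition open_cproj :: "'a cproj set \<Rightarrow> bool" where
  "open_cproj U \<longleftrightarrow> open {v. v \<noteq> 0 \<and> cline v \<in> U}"

instance
proof
  show "open (UNIV :: 'a cproj set)"
  proof -
    have "{v :: complex ^ 'a. v \<noteq> 0 \<and> cline v \<in> UNIV} = - {0}" by auto
    then show ?thesis unfolding open_cproj_def by (simp only: open_Compl closed_singleton)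
  qed
next
  fix S T :: "'a cproj set"
  assume "open S" "open T"
  moreover have "{v. v \<noteq> 0 \<and> cline v \<in> S \<inter> T}
      = {v. v \<noteq> 0 \<and> cline v \<in> S} \<inter> {v. v \<noteq> 0 \<and> cline v \<in> T}" by auto
  ultimately show "open (S \<inter> T)" unfolding open_cproj_def by (simp only: open_Int)
next
  fix K :: "'a cproj set set"
  assume K: "\<forall>S\<in>K. open S"
  have "{v. v \<noteq> 0 \<and> cline v \<in> \<Union>K} = (\<Union>S\<in>K. {v. v \<noteq> 0 \<and> cline v \<in> S})" by auto
  with K show "open (\<Union>K)" unfolding open_cproj_def by (simp only: open_UN)
qed

end

text \<open>The standard affine charts: the \<open>i\<close>-th one identifies the points with non-zero \<open>i\<close>-th
  homogeneous coordinate with the affine hyperplane \<open>v $ i = 1\<close> of \<^typ>\<open>complex ^ 'n\<close>.\<close>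

definition chart_dom :: "'n \<Rightarrow> 'n::finite cproj set" where
  "chart_dom i = {p. \<exists>v\<in>Rep_cproj p. v $ i \<noteq> 0}"

definition chart :: "'n \<Rightarrow> 'n::finite cproj \<Rightarrow> complex ^ 'n" where
  "chart i p = (THE v. v \<in> Rep_cproj p \<and> v $ i = 1)"

definition chart_image :: "'n \<Rightarrow> 'n::finite cproj set \<Rightarrow> (complex ^ 'n) set" where
  "chart_image i S = chart i ` (S \<inter> chart_dom i)"


section \<open>Closed algebraic subsets, hyperplanes and pencils\<close>

definition homogeneous_poly :: "nat \<Rightarrow> (complex ^ 'n::finite \<Rightarrow> complex) \<Rightarrow> bool" where
  "homogeneous_poly d f \<longleftrightarrow>
     (\<exists>E :: ('n \<Rightarrow> nat) set. \<exists>c. finite E \<and> (\<forall>e\<in>E. (\<Sum>i\<in>UNIV. e i) = d) \<and>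
        f = (\<lambda>v. \<Sum>e\<in>E. c e * (\<Prod>i\<in>UNIV. (v $ i) ^ e i)))"

definition closed_algebraic :: "'n::finite cproj set \<Rightarrow> bool" where
  "closed_algebraic S \<longleftrightarrow>
     (\<exists>F. (\<forall>f\<in>F. \<exists>d. homogeneous_poly d f) \<and> S = {p. \<forall>f\<in>F. \<forall>v\<in>Rep_cproj p. f v = 0})"

definition hyperplane_of :: "complex ^ 'n \<Rightarrow> 'n::finite cproj set" where
  "hyperplane_of a = {p. \<forall>v\<in>Rep_cproj p. (\<Sum>i\<in>UNIV. a $ i * v $ i) = 0}"

definition proj_hyperplane :: "'n::finite cproj set \<Rightarrow> bool" where
  "proj_hyperplane H \<longleftrightarrow> (\<exists>a. a \<noteq> 0 \<and> H = hyperplane_of a)"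

text \<open>Two linearly independent linear forms \<open>a\<close>, \<open>b\<close> span a pencil, parametrized by the projective
  line \<^typ>\<open>2 cproj\<close>: the member with parameter \<open>[s : t]\<close> has the equation \<open>s a + t b = 0\<close>.\<close>

definition is_pencil :: "complex ^ 'n::finite \<Rightarrow> complex ^ 'n \<Rightarrow> bool" where
  "is_pencil a b \<longleftrightarrow> (\<forall>s t. s *s a + t *s b = 0 \<longrightarrow> s = 0 \<and> t = 0)"

definition pencil_member :: "complex ^ 'n \<Rightarrow> complex ^ 'n \<Rightarrow> 2 cproj \<Rightarrow> 'n::finite cproj set" where
  "pencil_member a b \<mu> = {p. \<forall>m\<in>Rep_cproj \<mu>. p \<in> hyperplane_of (m $ 1 *s a + m $ 2 *s b)}"

definition pencil_axis :: "complex ^ 'n \<Rightarrow> complex ^ 'n \<Rightarrow> 'n::finite cproj set" where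
  "pencil_axis a b = hyperplane_of a \<inter> hyperplane_of b"


section \<open>Whitney stratifications and transversality\<close>

definition holo_map_on :: "(complex ^ 'n::finite \<Rightarrow> complex ^ 'n) \<Rightarrow> (complex ^ 'n) set \<Rightarrow> bool" where
  "holo_map_on f U \<longleftrightarrow>
     (\<forall>x\<in>U. \<exists>f'. (f has_derivative f') (at x) \<and> (\<forall>c v. f' (c *s v) = c *s f' v))"

definition complex_submanifold :: "(complex ^ 'n::finite) set \<Rightarrow> bool" where
  "complex_submanifold S \<longleftrightarrow>
     (\<forall>p\<in>S. \<exists>U V \<phi> \<psi> E. open U \<and> p \<in> U \<and> open V \<and> homeomorphism U V \<phi> \<psi> \<and>
        holo_map_on \<phi> U \<and> holo_map_on \<psi> V \<and> vec.subspace E \<and> \<phi> ` (S \<inter> U) = V \<inter> E)"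

text \<open>Velocities at \<open>p\<close> of curves in \<open>S\<close>; for a submanifold \<open>S\<close> this is its tangent space at \<open>p\<close>.\<close>

definition tangent_space :: "(complex ^ 'n::finite) set \<Rightarrow> complex ^ 'n \<Rightarrow> (complex ^ 'n) set" where
  "tangent_space S p =
     {v. \<exists>\<gamma>::real \<Rightarrow> complex ^ 'n. \<gamma> 0 = p \<and> (\<forall>t. \<gamma> t \<in> S) \<and> (\<gamma> has_vector_derivative v) (at 0)}"

text \<open>Convergence in a Grassmannian: since the dimensions agree, it amounts to \<open>E\<close> being the set of
  the limits of convergent sequences with \<open>k\<close>-th term in \<open>T k\<close>.\<close>

definition subspaces_tendsto ::
    "(nat \<Rightarrow> (complex ^ 'n::finite) set) \<Rightarrow> (complex ^ 'n) set \<Rightarrow> bool" where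
  "subspaces_tendsto T E \<longleftrightarrow>
     vec.subspace E \<and> (\<forall>k. vec.subspace (T k) \<and> vec.dim (T k) = vec.dim E) \<and>
     E = {v. \<exists>u. (\<forall>k. u k \<in> T k) \<and> u \<longlonglongrightarrow> v}"

definition whitney_a :: "(complex ^ 'n::finite) set \<Rightarrow> (complex ^ 'n) set \<Rightarrow> bool" where
  "whitney_a R S \<longleftrightarrow>
     (\<forall>y\<in>S. \<forall>x E. (\<forall>k. x k \<in> R) \<and> x \<longlonglongrightarrow> y \<and>
        subspaces_tendsto (\<lambda>k. tangent_space R (x k)) E \<longrightarrow> tangent_space S y \<subseteq> E)"

definition whitney_b :: "(complex ^ 'n::finite) set \<Rightarrow> (complex ^ 'n) set \<Rightarrow> bool" where
  "whitney_b R S \<longleftrightarrow>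
     (\<forall>y\<in>S. \<forall>x z E l. (\<forall>k. x k \<in> R) \<and> (\<forall>k. z k \<in> S) \<and> x \<longlonglongrightarrow> y \<and> z \<longlonglongrightarrow> y \<and>
        subspaces_tendsto (\<lambda>k. tangent_space R (x k)) E \<and>
        subspaces_tendsto (\<lambda>k. vec.span {x k - z k}) l \<longrightarrow> l \<subseteq> E)"

text \<open>Projective space being compact, local finiteness means finiteness.\<close>

definition whitney_stratification :: "'n::finite cproj set set \<Rightarrow> 'n cproj set \<Rightarrow> bool" where
  "whitney_stratification \<S> Y \<longleftrightarrow>
     finite \<S> \<and> \<Union>\<S> = Y \<and> pairwise disjnt \<S> \<and>
     (\<forall>S\<in>\<S>. S \<noteq> {} \<and> connected S \<and> (\<forall>i. complex_submanifold (chart_image i S))) \<and>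
     (\<forall>R\<in>\<S>. \<forall>S\<in>\<S>. S \<inter> closure R \<noteq> {} \<longrightarrow> S \<subseteq> closure R) \<and>
     (\<forall>R\<in>\<S>. \<forall>S\<in>\<S>. R \<noteq> S \<longrightarrow>
        (\<forall>i. whitney_a (chart_image i R) (chart_image i S) \<and>
             whitney_b (chart_image i R) (chart_image i S)))"

text \<open>At every common point, the tangent spaces of \<open>A\<close> and of the stratum through that point
  together span the tangent space of the ambient projective space.\<close>

definition transverse_to :: "'n::finite cproj set \<Rightarrow> 'n cproj set set \<Rightarrow> bool" where
  "transverse_to A \<S> \<longleftrightarrow>
     (\<forall>S\<in>\<S>. \<forall>i. \<forall>w \<in> chart_image i S \<inter> chart_image i A.
        {s + t | s t. s \<in> tangent_space (chart_image i S) w \<and> t \<in> tangent_space (chart_image i A) w}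
          = tangent_space (chart_image i UNIV) w)"


section \<open>Semi-analytic disks, arcs and loops in the projective line\<close>

text \<open>For \<^typ>\<open>2 cproj\<close>, the chart with index \<open>i\<close> has the single non-trivial coordinate \<open>i + 1\<close>,
  computed in the ring \<^typ>\<open>2\<close>.\<close>

definition line_coord :: "2 \<Rightarrow> 2 cproj \<Rightarrow> complex" where
  "line_coord i p = chart i p $ (i + 1)"

definition plane_analytic_on :: "(complex \<Rightarrow> real) \<Rightarrow> complex set \<Rightarrow> bool" where
  "plane_analytic_on f W \<longleftrightarrow>
     (\<forall>a\<in>W. \<exists>c r. 0 < r \<and>
        (\<forall>z\<in>ball a r. ((\<lambda>(j, k). c j k * Re (z - a) ^ j * Im (z - a) ^ k) has_sum f z) (UNIV :: (nat \<times> nat) set)))"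

definition plane_semianalytic :: "complex set \<Rightarrow> bool" where
  "plane_semianalytic A \<longleftrightarrow>
     (\<forall>a. \<exists>W \<B>. open W \<and> a \<in> W \<and> finite \<B> \<and>
        (\<forall>(F, G)\<in>\<B>. finite F \<and> finite G \<and> (\<forall>f\<in>F \<union> G. plane_analytic_on f W)) \<and>
        A \<inter> W = (\<Union>(F, G)\<in>\<B>. {z\<in>W. (\<forall>f\<in>F. f z = 0) \<and> (\<forall>g\<in>G. 0 < g z)}))"

definition line_semianalytic :: "2 cproj set \<Rightarrow> bool" where
  "line_semianalytic A \<longleftrightarrow> (\<forall>i. plane_semianalytic (line_coord i ` (A \<inter> chart_dom i)))"

text \<open>The disks are small in the sense that each of them lies in one of the two standard charts.\<close>

definition semianalytic_disk :: "2 cproj set \<Rightarrow> 2 cproj \<Rightarrow> bool" where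
  "semianalytic_disk D p \<longleftrightarrow>
     line_semianalytic D \<and> (\<exists>i. D \<subseteq> chart_dom i) \<and>
     (\<exists>\<phi> \<psi>. homeomorphism (cball (0::complex) 1) D \<phi> \<psi> \<and> \<phi> 0 = p)"

definition analytic_arc :: "(real \<Rightarrow> 2 cproj) \<Rightarrow> bool" where
  "analytic_arc g \<longleftrightarrow> arc g \<and>
     (\<forall>t\<in>{0..1}. \<exists>i c r. 0 < r \<and>
        (\<forall>s\<in>{0..1} \<inter> ball t r. g s \<in> chart_dom i \<and>
            (\<lambda>k. c k * of_real (s - t) ^ k) sums line_coord i (g s)))"

definition arc_disk_system ::
    "2 cproj \<Rightarrow> 'i set \<Rightarrow> ('i \<Rightarrow> 2 cproj) \<Rightarrow> ('i \<Rightarrow> 2 cproj set) \<Rightarrow> ('i \<Rightarrow> real \<Rightarrow> 2 cproj) \<Rightarrow> bool" where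
  "arc_disk_system p I c D g \<longleftrightarrow>
     (\<forall>i\<in>I. semianalytic_disk (D i) (c i) \<and> analytic_arc (g i) \<and>
        pathstart (g i) = p \<and> pathfinish (g i) \<in> frontier (D i) \<and>
        path_image (g i) \<inter> D i = {pathfinish (g i)}) \<and>
     (\<forall>i\<in>I. \<forall>j\<in>I. i \<noteq> j \<longrightarrow> D i \<inter> D j = {} \<and> path_image (g i) \<inter> D j = {} \<and>
        path_image (g i) \<inter> path_image (g j) = {p})"

definition goes_once_around :: "(real \<Rightarrow> 2 cproj) \<Rightarrow> 2 cproj set \<Rightarrow> 2 cproj \<Rightarrow> bool" where
  "goes_once_around e D p \<longleftrightarrow>
     simple_path e \<and> pathfinish e = pathstart e \<and> path_image e = frontier D \<and>
     (\<exists>i. D \<subseteq> chart_dom i \<and> winding_number (line_coord i \<circ> e) (line_coord i p) = 1)"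

definition lasso_loop ::
    "(real \<Rightarrow> 2 cproj) \<Rightarrow> 2 cproj set \<Rightarrow> 2 cproj \<Rightarrow> (real \<Rightarrow> 2 cproj) \<Rightarrow> bool" where
  "lasso_loop g D p \<omega> \<longleftrightarrow>
     (\<exists>e. goes_once_around e D p \<and> pathstart e = pathfinish g \<and> \<omega> = g +++ (e +++ reversepath g))"


section \<open>Geometric monodromy and homological variation\<close>

definition geometric_monodromy ::
    "(2 cproj \<Rightarrow> 'n::finite cproj set) \<Rightarrow> 'n cproj set \<Rightarrow> 'n cproj set \<Rightarrow> 'n cproj set \<Rightarrow>
     2 cproj set \<Rightarrow> (real \<Rightarrow> 2 cproj) \<Rightarrow> ('n cproj \<Rightarrow> 'n cproj) \<Rightarrow> bool" where
  "geometric_monodromy P X L M K \<omega> h \<longleftrightarrow>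
     (\<exists>\<Theta> :: 'n cproj \<times> real \<Rightarrow> 'n cproj.
        continuous_map (prod_topology (top_of_set (L \<inter> X)) (top_of_set {0..1}))
          (top_of_set (\<Union>\<mu>\<in>frontier K. X \<inter> P \<mu>)) \<Theta> \<and>
        (\<forall>x\<in>L \<inter> X. \<Theta> (x, 0) = x) \<and>
        (\<forall>t\<in>{0..1}. homeomorphic_map (top_of_set (L \<inter> X)) (top_of_set (X \<inter> P (\<omega> t))) (\<lambda>x. \<Theta> (x, t))) \<and>
        (\<forall>t\<in>{0..1}. \<forall>x\<in>M \<inter> X. \<Theta> (x, t) = x) \<and>
        (\<forall>x\<in>L \<inter> X. h x = \<Theta> (x, 1)))"

text \<open>Here and below, an operator on classes is given by its values on representatives;
  \<^const>\<open>the_elem\<close> picks the common value.\<close>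

definition homological_variation ::
    "nat \<Rightarrow> 'a topology \<Rightarrow> ('a \<Rightarrow> 'a) \<Rightarrow> 'a chain set \<Rightarrow> 'a chain set" where
  "homological_variation q A h c =
     the_elem ((\<lambda>z. homologous_rel_set q A {} (chain_map q h z - z)) ` c)"


section \<open>Homotopy classes of cubes and Hurewicz maps\<close>

definition cube :: "nat \<Rightarrow> (nat \<Rightarrow> real) set" where
  "cube q = {x. (\<forall>i. 0 \<le> x i \<and> x i \<le> 1) \<and> (\<forall>i. i \<notin> {1..q} \<longrightarrow> x i = 0)}"

definition cube_boundary :: "nat \<Rightarrow> (nat \<Rightarrow> real) set" where
  "cube_boundary q = {x \<in> cube q. \<exists>i\<in>{1..q}. x i = 0 \<or> x i = 1}"

definition cube_topology :: "nat \<Rightarrow> (nat \<Rightarrow> real) topology" where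
  "cube_topology q = subtopology (powertop_real UNIV) (cube q)"

text \<open>The sets \<open>F\<^sup>q(A, B, *)\<close> and \<open>F\<^sup>q(A, *)\<close>. Two functions that agree on the cube have the same
  homotopy class, so their values elsewhere are immaterial.\<close>

definition rel_cubes :: "nat \<Rightarrow> 'a topology \<Rightarrow> 'a set \<Rightarrow> 'a \<Rightarrow> ((nat \<Rightarrow> real) \<Rightarrow> 'a) set" where
  "rel_cubes q A B b =
     {f. continuous_map (cube_topology q) A f \<and>
         (\<forall>x\<in>cube q. x q = 0 \<longrightarrow> f x \<in> B) \<and>
         (\<forall>x\<in>cube q. x q = 1 \<or> (\<exists>i\<in>{1..<q}. x i = 0 \<or> x i = 1) \<longrightarrow> f x = b)}"

definition abs_cubes :: "nat \<Rightarrow> 'a topology \<Rightarrow> 'a \<Rightarrow> ((nat \<Rightarrow> real) \<Rightarrow> 'a) set" where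
  "abs_cubes q A b =
     {f. continuous_map (cube_topology q) A f \<and> (\<forall>x\<in>cube_boundary q. f x = b)}"

text \<open>Homotopy through elements of a set \<open>F\<close> of cubes.\<close>

definition cube_homotopy ::
    "nat \<Rightarrow> 'a topology \<Rightarrow> ((nat \<Rightarrow> real) \<Rightarrow> 'a) set \<Rightarrow>
     (((nat \<Rightarrow> real) \<Rightarrow> 'a) \<times> ((nat \<Rightarrow> real) \<Rightarrow> 'a)) set" where
  "cube_homotopy q A F = {(f, g). homotopic_with (\<lambda>k. k \<in> F) (cube_topology q) A f g}"

definition rel_homotopy_set ::
    "nat \<Rightarrow> 'a topology \<Rightarrow> 'a set \<Rightarrow> 'a \<Rightarrow> ((nat \<Rightarrow> real) \<Rightarrow> 'a) set set" where
  "rel_homotopy_set q A B b = rel_cubes q A B b // cube_homotopy q A (rel_cubes q A B b)"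

definition abs_homotopy_set ::
    "nat \<Rightarrow> 'a topology \<Rightarrow> 'a \<Rightarrow> ((nat \<Rightarrow> real) \<Rightarrow> 'a) set set" where
  "abs_homotopy_set q A b = abs_cubes q A b // cube_homotopy q A (abs_cubes q A b)"

definition cube_join ::
    "nat \<Rightarrow> ((nat \<Rightarrow> real) \<Rightarrow> 'a) \<Rightarrow> ((nat \<Rightarrow> real) \<Rightarrow> 'a) \<Rightarrow> (nat \<Rightarrow> real) \<Rightarrow> 'a" where
  "cube_join q f g = (\<lambda>x. if x q \<le> 1/2 then f (x(q := 1 - 2 * x q)) else g (x(q := 2 * x q - 1)))"

definition homotopical_variation ::
    "nat \<Rightarrow> 'a topology \<Rightarrow> 'a \<Rightarrow> ('a \<Rightarrow> 'a) \<Rightarrow> ((nat \<Rightarrow> real) \<Rightarrow> 'a) set \<Rightarrow> ((nat \<Rightarrow> real) \<Rightarrow> 'a) set" where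
  "homotopical_variation q A b h c =
     the_elem ((\<lambda>f. cube_homotopy q A (abs_cubes q A b) `` {cube_join q f (h \<circ> f)}) ` c)"

text \<open>The identity of the \<open>q\<close>-cube as a simplicial singular chain: the cube is cut into the simplices
  \<open>x\<^bsub>\<sigma> 1\<^esub> \<ge> \<dots> \<ge> x\<^bsub>\<sigma> q\<^esub>\<close>, one for each permutation \<open>\<sigma>\<close>; the \<open>j\<close>-th vertex of such a simplex is the
  sum of the first \<open>j\<close> basis vectors in the order given by \<open>\<sigma>\<close>.\<close>

definition cube_chain :: "nat \<Rightarrow> (nat \<Rightarrow> real) chain" where
  "cube_chain q =
     (\<Sum>\<sigma> | \<sigma> permutes {1..q}.
        frag_cmul (sign \<sigma>) (frag_of (oriented_simplex q (\<lambda>j i. if i \<in> \<sigma> ` {1..j} then 1 else 0))))"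

definition cube_class :: "nat \<Rightarrow> (nat \<Rightarrow> real) chain set" where
  "cube_class q = homologous_rel_set q (cube_topology q) (cube_boundary q) (cube_chain q)"

definition rel_hurewicz ::
    "nat \<Rightarrow> 'a topology \<Rightarrow> 'a set \<Rightarrow> ((nat \<Rightarrow> real) \<Rightarrow> 'a) set \<Rightarrow> 'a chain set" where
  "rel_hurewicz q A B c =
     the_elem ((\<lambda>f. hom_induced (int q) (cube_topology q) (cube_boundary q) A B f (cube_class q)) ` c)"

text \<open>A cube with boundary at the base point \<open>b\<close> gives a class in the homology of \<open>A\<close> modulo \<open>b\<close>,
  which is the homology of \<open>A\<close> because \<open>q \<ge> 1\<close>.\<close>

definition abs_hurewicz ::
    "nat \<Rightarrow> 'a topology \<Rightarrow> 'a \<Rightarrow> ((nat \<Rightarrow> real) \<Rightarrow> 'a) set \<Rightarrow> 'a chain set" where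
  "abs_hurewicz q A b c =
     inv_into (carrier (homology_group (int q) A)) (hom_induced (int q) A {} A {b} id)
       (rel_hurewicz q A {b} c)"

end

theory Submission
  imports Defs
begin

text \<open>The geometry enters only through the fact that \<open>h\<close> is a continuous self-map of \<open>A\<close> fixing \<open>B\<close>
  pointwise, where \<open>A\<close> is the section of \<open>X\<close> by \<open>L\<close> and \<open>B\<close> its section by the axis. If \<open>z\<close> is the image
  under \<open>f\<close> of the chain of the cube, the homological variation of its class is represented by the
  absolute cycle \<open>h z - z\<close>. The join of \<open>f\<close> and \<open>h \<circ> f\<close> maps the two halves of the cube, parametrized
  from the middle outwards, by \<open>f\<close> and by \<open>h \<circ> f\<close>. So everything reduces to the claim that modulo the
  boundary the cube is homologous to its upper half minus its reflected lower half, which is seen by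
  shrinking the lower half to a face.\<close>

section \<open>The simplicial subdivision of the cube and its boundary\<close>

text \<open>Points of the simplex are convex combinations of its vertices, and the inequalities of
  the cube as well as the equation \<open>x i = v\<close> survive convex combinations.\<close>

lemma oriented_simplex_in_facet:
  assumes l: "\<And>j. j \<le> p \<Longrightarrow> l j \<in> cube q" and v: "\<And>j. j \<le> p \<Longrightarrow> l j i = v"
  shows "simplicial_simplex p {x \<in> cube q. x i = v} (oriented_simplex p l)"
  unfolding simplicial_simplex_oriented_simplex
proof (intro image_subsetI)
  fix x assume x: "x \<in> standard_simplex p"
  then have x0: "\<And>j. 0 \<le> x j" and x1: "(\<Sum>j\<le>p. x j) = 1"
    by (auto simp: standard_simplex_def)
  have "(\<Sum>j\<le>p. l j k * x j) \<le> (\<Sum>j\<le>p. x j)" for k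
    using l x0 by (intro sum_mono) (auto simp: cube_def mult_left_le_one_le)
  moreover have "0 \<le> (\<Sum>j\<le>p. l j k * x j)" for k
    using l x0 by (intro sum_nonneg) (auto simp: cube_def)
  moreover have "(\<Sum>j\<le>p. l j k * x j) = 0" if "k \<notin> {1..q}" for k
    using l that by (intro sum.neutral) (auto simp: cube_def)
  moreover have "(\<Sum>j\<le>p. l j i * x j) = v"
    using v x1 by (simp flip: sum_distrib_left)
  ultimately show "(\<lambda>k. \<Sum>j\<le>p. l j k * x j) \<in> {x \<in> cube q. x i = v}"
    using x1 by (simp add: cube_def)
qed

definition cube_vertex :: "(nat \<Rightarrow> nat) \<Rightarrow> nat \<Rightarrow> nat \<Rightarrow> real" where
  "cube_vertex \<sigma> j = (\<lambda>i. if i \<in> \<sigma> ` {1..j} then 1 else 0)"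

lemma cube_vertex_in_cube:
  assumes "\<sigma> permutes {1..q}" "j \<le> q"
  shows "cube_vertex \<sigma> j \<in> cube q"
proof -
  have "\<sigma> ` {1..j} \<subseteq> {1..q}"
    using assms by (metis atLeastatMost_subset_iff image_mono order_refl permutes_image)
  then show ?thesis
    by (auto simp: cube_vertex_def cube_def)
qed

lemma cube_chain_eq:
  "cube_chain q =
     (\<Sum>\<sigma> | \<sigma> permutes {1..q}. frag_cmul (sign \<sigma>) (frag_of (oriented_simplex q (cube_vertex \<sigma>))))"
  unfolding cube_chain_def cube_vertex_def ..

lemma singular_chain_cube_chain: "singular_chain q (cube_topology q) (cube_chain q)"
  unfolding cube_chain_eq cube_topology_def
proof (intro singular_chain_sum singular_chain_cmul)
  fix \<sigma> assume "\<sigma> \<in> {\<sigma>. \<sigma> permutes {1..q}}"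
  \<comment> \<open>The coordinate with index 0 vanishes on the whole cube, so this "facet" is the
    cube itself.\<close>
  then have "simplicial_simplex q {x \<in> cube q. x 0 = 0} (oriented_simplex q (cube_vertex \<sigma>))"
    using cube_vertex_in_cube[of \<sigma> q]
    by (intro oriented_simplex_in_facet) (force simp: cube_def)+
  then have "singular_simplex q (subtopology (powertop_real UNIV) (cube q)) (oriented_simplex q (cube_vertex \<sigma>))"
    by (blast intro: singular_simplex_mono dest: simplicial_imp_singular_simplex)
  then show "singular_chain q (subtopology (powertop_real UNIV) (cube q))
      (frag_of (oriented_simplex q (cube_vertex \<sigma>)))"
    by (simp add: singular_chain_of)
qed

text \<open>A face of a simplex of the subdivision, not of the cube. Its vertices are listed
  explicitly, so that faces of different simplices can be compared vertex by vertex.\<close>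

definition cube_face :: "nat \<Rightarrow> nat \<Rightarrow> (nat \<Rightarrow> nat) \<Rightarrow> (nat \<Rightarrow> real) \<Rightarrow> nat \<Rightarrow> real" where
  "cube_face q k \<sigma> =
     oriented_simplex (q - 1) (\<lambda>j. if j < k then cube_vertex \<sigma> j else cube_vertex \<sigma> (Suc j))"

text \<open>An inner face of a simplex of the subdivision is shared with the simplex obtained by a
  transposition, which has the opposite sign.\<close>

lemma inner_cube_faces_cancel:
  assumes k: "1 \<le> k" "k < q"
  shows "(\<Sum>\<sigma> | \<sigma> permutes {1..q}. frag_cmul (sign \<sigma>) (frag_of (cube_face q k \<sigma>))) = 0"
    (is "sum ?F ?P = 0")
proof -
  define \<tau> where "\<tau> = Transposition.transpose k (Suc k)"
  have \<tau>: "\<tau> permutes {1..q}"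
    unfolding \<tau>_def using k by (intro permutes_swap_id) auto
  have \<tau>\<tau>: "\<tau> \<circ> \<tau> = id"
    by (simp add: \<tau>_def)
  \<comment> \<open>For \<open>j \<noteq> k\<close> the set \<open>{1..j}\<close> contains both or
    neither of the swapped indices. Hence \<open>\<sigma>\<close> and
    \<open>\<sigma> \<circ> \<tau>\<close> differ only in vertex \<open>k\<close>, the one that the
    face omits.\<close>
  have img: "\<tau> ` {1..j} = {1..j}" if "j \<noteq> k" for j
    unfolding \<tau>_def using that k by (intro transpose_image_eq) auto
  have F: "?F (\<sigma> \<circ> \<tau>) = - ?F \<sigma>" if \<sigma>: "\<sigma> permutes {1..q}" for \<sigma>
  proof -
    have "sign (\<sigma> \<circ> \<tau>) = - sign \<sigma>"
      using sign_compose[OF permutes_imp_permutation[OF _ \<sigma>] permutes_imp_permutation[OF _ \<tau>]]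
      by (simp add: sign_swap_id \<tau>_def)
    moreover have "cube_vertex (\<sigma> \<circ> \<tau>) j = cube_vertex \<sigma> j" if "j \<noteq> k" for j
      unfolding cube_vertex_def image_comp[symmetric] img[OF that] ..
    then have "cube_face q k (\<sigma> \<circ> \<tau>) = cube_face q k \<sigma>"
      unfolding cube_face_def oriented_simplex_eq by auto
    ultimately show ?thesis
      by simp
  qed
  have "sum ?F ?P = (\<Sum>\<sigma>\<in>?P. ?F (\<sigma> \<circ> \<tau>))"
    using permutes_compose[OF \<tau>]
    by (intro sum.reindex_bij_witness[where i = "\<lambda>\<sigma>. \<sigma> \<circ> \<tau>" and j = "\<lambda>\<sigma>. \<sigma> \<circ> \<tau>"])
      (auto simp: comp_assoc \<tau>\<tau>)
  also have "\<dots> = - sum ?F ?P"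
    by (subst sum_negf[symmetric], rule sum.cong[OF refl], rule F) simp
  finally have eq: "sum ?F ?P = - sum ?F ?P" .
  show ?thesis
  proof (rule poly_mapping_eqI)
    fix s
    have "Poly_Mapping.lookup (sum ?F ?P) s = - Poly_Mapping.lookup (sum ?F ?P) s"
      using arg_cong[OF eq, of "\<lambda>c. Poly_Mapping.lookup c s"] by (simp only: lookup_uminus)
    then show "Poly_Mapping.lookup (sum ?F ?P) s = Poly_Mapping.lookup 0 s"
      by simp
  qed
qed

text \<open>For each \<open>k\<close> strictly between 0 and \<open>q\<close> the
  \<open>k\<close>-th faces cancel in pairs, which leaves the faces that omit the first or the last
  vertex.\<close>

lemma chain_boundary_cube_chain:
  assumes q: "q \<ge> 1"
  shows "chain_boundary q (cube_chain q) =
    (\<Sum>k\<in>{0,q}. \<Sum>\<sigma> | \<sigma> permutes {1..q}.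
       frag_cmul ((-1) ^ k) (frag_cmul (sign \<sigma>) (frag_of (cube_face q k \<sigma>))))"
proof -
  let ?P = "{\<sigma>. \<sigma> permutes {1..q}}"
  let ?G = "\<lambda>k \<sigma>. frag_cmul ((-1) ^ k) (frag_cmul (sign \<sigma>) (frag_of (cube_face q k \<sigma>)))"
  have "chain_boundary q (frag_cmul (sign \<sigma>) (frag_of (oriented_simplex q (cube_vertex \<sigma>))))
      = (\<Sum>k\<le>q. ?G k \<sigma>)" for \<sigma>
    using q by (simp add: chain_boundary_cmul chain_boundary_of frag_cmul_sum
        singular_face_oriented_simplex cube_face_def mult.commute)
  then have "chain_boundary q (cube_chain q) = (\<Sum>\<sigma>\<in>?P. \<Sum>k\<le>q. ?G k \<sigma>)"
    by (simp add: cube_chain_eq chain_boundary_sum)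
  also have "\<dots> = (\<Sum>k\<le>q. sum (?G k) ?P)"
    by (rule sum.swap)
  also have "\<dots> = (\<Sum>k\<in>{0,q}. sum (?G k) ?P)"
  proof (rule sum.mono_neutral_right)
    have "sum (?G k) ?P = 0" if "1 \<le> k" "k < q" for k
      unfolding frag_cmul_sum[symmetric] inner_cube_faces_cancel[OF that] by simp
    then show "\<forall>k\<in>{..q} - {0,q}. sum (?G k) ?P = 0"
      by auto
  qed auto
  finally show ?thesis .
qed

text \<open>The facet of each boundary simplex is recorded, because the doubling of the cube treats
  the facet \<open>x q = 0\<close> differently from the others.\<close>

lemma keys_boundary_cube_chain:
  assumes q: "q \<ge> 1" and s: "s \<in> Poly_Mapping.keys (chain_boundary q (cube_chain q))"
  shows "\<exists>i\<in>{1..q}. \<exists>v\<in>{0,1}. singular_simplex (q - 1) (subtopology (cube_topology q) {x. x i = v}) s"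
proof -
  have "s \<in> (\<Union>k\<in>{0,q}. \<Union>\<sigma>\<in>{\<sigma>. \<sigma> permutes {1..q}}. {cube_face q k \<sigma>})"
  proof -
    have "Poly_Mapping.keys (\<Sum>k\<in>{0,q}. \<Sum>\<sigma> | \<sigma> permutes {1..q}.
        frag_cmul ((-1) ^ k) (frag_cmul (sign \<sigma>) (frag_of (cube_face q k \<sigma>))))
       \<subseteq> (\<Union>k\<in>{0,q}. \<Union>\<sigma>\<in>{\<sigma>. \<sigma> permutes {1..q}}. {cube_face q k \<sigma>})"
      by (intro order_trans[OF keys_sum] UN_mono subset_refl order_trans[OF keys_cmul]) simp
    then show ?thesis
      using s chain_boundary_cube_chain[OF q] by auto
  qed
  then obtain k \<sigma> where k: "k = 0 \<or> k = q" and \<sigma>: "\<sigma> permutes {1..q}" and sk: "s = cube_face q k \<sigma>"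
    by blast
  \<comment> \<open>Without the origin, all vertices have coordinate \<open>\<sigma> 1\<close> equal
    to 1; without the last vertex, all have coordinate \<open>\<sigma> q\<close> equal to 0.\<close>
  define i where "i = (if k = 0 then \<sigma> 1 else \<sigma> q)"
  define v :: real where "v = (if k = 0 then 1 else 0)"
  have i: "i \<in> {1..q}"
    using q permutes_in_image[OF \<sigma>] by (auto simp: i_def)
  have "simplicial_simplex (q - 1) {x \<in> cube q. x i = v} s"
    unfolding sk cube_face_def
  proof (rule oriented_simplex_in_facet)
    fix j assume j: "j \<le> q - 1"
    then show "(if j < k then cube_vertex \<sigma> j else cube_vertex \<sigma> (Suc j)) \<in> cube q"
      using q cube_vertex_in_cube[OF \<sigma>] by auto
    have "\<sigma> q \<notin> \<sigma> ` {1..j}"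
      using j q permutes_inj[OF \<sigma>] by (auto dest!: injD)
    then show "(if j < k then cube_vertex \<sigma> j else cube_vertex \<sigma> (Suc j)) i = v"
      using j q k by (auto simp: i_def v_def cube_vertex_def)
  qed
  then have "singular_simplex (q - 1) (subtopology (powertop_real UNIV) {x \<in> cube q. x i = v}) s"
    by (rule simplicial_imp_singular_simplex)
  moreover have "{x \<in> cube q. x i = v} = cube q \<inter> {x. x i = v}"
    by auto
  ultimately have "singular_simplex (q - 1) (subtopology (cube_topology q) {x. x i = v}) s"
    by (simp add: cube_topology_def subtopology_subtopology)
  then show ?thesis
    using i by (auto simp: v_def split: if_splits)
qed

lemma singular_relcycle_cube_chain:
  assumes q: "q \<ge> 1"
  shows "singular_relcycle q (cube_topology q) (cube_boundary q) (cube_chain q)"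
proof -
  have "singular_simplex (q - 1) (subtopology (cube_topology q) (cube_boundary q)) s"
    if s: "s \<in> Poly_Mapping.keys (chain_boundary q (cube_chain q))" for s
  proof -
    obtain i v where i: "i \<in> {1..q}" "v \<in> {0,1}"
      and s: "singular_simplex (q - 1) (subtopology (cube_topology q) {x. x i = v}) s"
      using keys_boundary_cube_chain[OF q s] by blast
    have "cube q \<inter> {x. x i = v} \<subseteq> cube_boundary q"
      using i by (auto simp: cube_boundary_def)
    moreover have "cube q \<inter> cube_boundary q = cube_boundary q"
      by (auto simp: cube_boundary_def)
    ultimately show ?thesis
      using s unfolding cube_topology_def subtopology_subtopology
      by (metis singular_simplex_mono)
  qed
  then show ?thesis
    by (auto simp: singular_relcycle singular_chain_cube_chain) (auto simp: singular_chain_def)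
qed

section \<open>The cube as the difference of its two halves\<close>

text \<open>Boundary simplices in \<open>R\<close> have the same image under both maps and cancel,
  while those in \<open>S\<close> are sent into \<open>T\<close>. The difference of the images is
  additive in the boundary chain, so it suffices to look at single simplices. This glues two copies
  of a chain along \<open>R\<close>.\<close>

lemma singular_relcycle_chain_map_diff:
  assumes c: "singular_chain p X c"
    and f: "continuous_map X Y f" "f \<in> topspace X \<inter> S \<rightarrow> T"
    and g: "continuous_map X Y g" "g \<in> topspace X \<inter> S \<rightarrow> T"
    and fg: "\<And>x. x \<in> topspace X \<inter> R \<Longrightarrow> f x = g x"
    and faces: "\<And>s. s \<in> Poly_Mapping.keys (chain_boundary p c) \<Longrightarrow>
      singular_simplex (p - 1) (subtopology X R) s \<or> singular_simplex (p - 1) (subtopology X S) s"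
  shows "singular_relcycle p Y T (chain_map p f c - chain_map p g c)"
proof -
  have "Poly_Mapping.keys (chain_boundary p c) \<subseteq>
      singular_simplex_set (p - 1) (subtopology X R) \<union> singular_simplex_set (p - 1) (subtopology X S)"
    using faces by blast
  then have "singular_chain (p - 1) (subtopology Y T)
      (chain_map (p - 1) f (chain_boundary p c) - chain_map (p - 1) g (chain_boundary p c))"
  proof (induction rule: frag_induction)
    case (one s)
    then consider "singular_simplex (p - 1) (subtopology X R) s"
      | "singular_simplex (p - 1) (subtopology X S) s" by blast
    then show ?case
    proof cases
      case 1
      then have "simplex_map (p - 1) f s = simplex_map (p - 1) g s"
        using fg by (intro simplex_map_eq) auto
      then show ?thesis by simp
    next
      case 2
      have "continuous_map (subtopology X S) (subtopology Y T) f"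
        "continuous_map (subtopology X S) (subtopology Y T) g"
        using f g by (auto simp: continuous_map_in_subtopology continuous_map_from_subtopology)
      with 2 show ?thesis
        by (simp add: singular_chain_diff singular_chain_of singular_simplex_simplex_map)
    qed
  next
    case (diff a b)
    then have "singular_chain (p - 1) (subtopology Y T)
       ((chain_map (p - 1) f a - chain_map (p - 1) g a) - (chain_map (p - 1) f b - chain_map (p - 1) g b))"
      by (rule singular_chain_diff)
    then show ?case
      by (simp add: chain_map_diff algebra_simps)
  qed (simp_all)
  then show ?thesis
    using c f g
    by (simp add: singular_relcycle chain_boundary_diff chain_boundary_chain_map
        singular_chain_diff singular_chain_chain_map)
qed

text \<open>The two halves of the cube are treated as one relative cycle on the cube with last coordinate in
  \<open>[-1, 1]\<close>, so that moving them simultaneously needs only the homotopy invariance for maps of pairs.\<close>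

definition double_cube :: "nat \<Rightarrow> (nat \<Rightarrow> real) set" where
  "double_cube q = {x. x(q := \<bar>x q\<bar>) \<in> cube q}"

text \<open>Only the outer boundary: the facet \<open>x q = 0\<close>, along which the two halves
  meet, is left out.\<close>

definition double_cube_boundary :: "nat \<Rightarrow> (nat \<Rightarrow> real) set" where
  "double_cube_boundary q =
     {x \<in> double_cube q. \<bar>x q\<bar> = 1 \<or> (\<exists>i\<in>{1..<q}. x i = 0 \<or> x i = 1)}"

abbreviation double_cube_topology :: "nat \<Rightarrow> (nat \<Rightarrow> real) topology" where
  "double_cube_topology q \<equiv> subtopology (powertop_real UNIV) (double_cube q)"

lemma topspace_cube_topology [simp]: "topspace (cube_topology q) = cube q"
  by (simp add: cube_topology_def)

lemma fun_upd_in_cube_iff: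
  assumes "q \<ge> 1"
  shows "x(q := y) \<in> cube q \<longleftrightarrow> 0 \<le> y \<and> y \<le> 1 \<and> (\<forall>i. i \<noteq> q \<longrightarrow> 0 \<le> x i \<and> x i \<le> 1)
    \<and> (\<forall>i. i \<notin> {1..q} \<longrightarrow> x i = 0)"
proof -
  have "(\<forall>i. P i) \<longleftrightarrow> P q \<and> (\<forall>i. i \<noteq> q \<longrightarrow> P i)" for P :: "nat \<Rightarrow> bool"
    by metis
  from this[of "\<lambda>i. 0 \<le> (x(q := y)) i \<and> (x(q := y)) i \<le> 1"] show ?thesis
    using assms by (auto simp: cube_def)
qed

lemma continuous_map_cube_coordinate: "continuous_map (cube_topology q) euclideanreal (\<lambda>x. x i)"
  unfolding cube_topology_def
  by (intro continuous_map_from_subtopology continuous_map_product_projection) simp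

text \<open>The expression is the last coordinate of the homotopy \<open>H\<close> of the next
  proof. Its first term lies between 0 and \<open>1 - \<bar>y\<bar>\<close>, its second between 0
  and \<open>\<bar>y\<bar>\<close>.\<close>

lemma double_cube_homotopy_bounds:
  fixes s y :: real
  assumes "0 \<le> s" "s \<le> 1" "\<bar>y\<bar> \<le> 1"
  shows "0 \<le> s * (1 - \<bar>y\<bar>) + max 0 y" "s * (1 - \<bar>y\<bar>) + max 0 y \<le> 1"
proof -
  have "0 \<le> s * (1 - \<bar>y\<bar>)" "s * (1 - \<bar>y\<bar>) \<le> 1 - \<bar>y\<bar>"
    using assms by (auto simp: mult_left_le_one_le)
  then show "0 \<le> s * (1 - \<bar>y\<bar>) + max 0 y" "s * (1 - \<bar>y\<bar>) + max 0 y \<le> 1"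
    by (auto simp: max_def)
qed

text \<open>The cube minus its mirror image is a relative cycle \<open>e\<close> on the doubled
  cube. The affine bijection onto the cube sends \<open>e\<close> to the difference of the two
  halves; deforming it until the lower half is flat turns the image into the cube minus a chain in
  its boundary.\<close>

lemma homologous_rel_two_halves:
  assumes q: "q \<ge> 1"
  shows "homologous_rel q (cube_topology q) (cube_boundary q)
     (chain_map q (\<lambda>x. x(q := (1 + x q) / 2)) (cube_chain q)
        - chain_map q (\<lambda>x. x(q := (1 - x q) / 2)) (cube_chain q))
     (cube_chain q)"
proof -
  let ?C = "cube_topology q" and ?Q = "double_cube_topology q"
  define e where "e = chain_map q id (cube_chain q) - chain_map q (\<lambda>x. x(q := - x q)) (cube_chain q)"
  have e: "singular_relcycle q ?Q (double_cube_boundary q) e"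
    unfolding e_def
  proof (rule singular_relcycle_chain_map_diff[OF singular_chain_cube_chain])
    \<comment> \<open>Faces in \<open>?R\<close> are fixed by the reflection and cancel; faces in
      \<open>?S\<close> end up on the outer boundary.\<close>
    let ?S = "{x. x q = 1 \<or> (\<exists>i\<in>{1..<q}. x i = 0 \<or> x i = 1)}" and ?R = "{x :: nat \<Rightarrow> real. x q = 0}"
    have sub: "cube q \<subseteq> double_cube q"
      by (auto simp: double_cube_def cube_def fun_upd_idem)
    show "continuous_map ?C ?Q id"
      unfolding cube_topology_def using sub
      by (auto simp: continuous_map_in_subtopology intro: continuous_map_from_subtopology)
    have "continuous_map ?C (powertop_real UNIV) (\<lambda>x. x(q := - x q))"
      unfolding continuous_map_componentwise_UNIV
      by (auto simp: fun_upd_def intro!: continuous_map_minus continuous_map_cube_coordinate)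
    then show "continuous_map ?C ?Q (\<lambda>x. x(q := - x q))"
      by (auto simp: continuous_map_in_subtopology double_cube_def cube_def)
    show "id \<in> topspace ?C \<inter> ?S \<rightarrow> double_cube_boundary q"
      using sub by (auto simp: double_cube_boundary_def)
    show "(\<lambda>x. x(q := - x q)) \<in> topspace ?C \<inter> ?S \<rightarrow> double_cube_boundary q"
      by (auto simp: double_cube_boundary_def double_cube_def cube_def)
    show "id x = x(q := - x q)" if "x \<in> topspace ?C \<inter> ?R" for x
      using that by auto
    fix s assume "s \<in> Poly_Mapping.keys (chain_boundary q (cube_chain q))"
    then obtain i v where i: "i \<in> {1..q}" "v \<in> {0,1}"
      and s: "singular_simplex (q - 1) (subtopology ?C {x. x i = v}) s"
      using keys_boundary_cube_chain[OF q] by blast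
    have "{x. x i = v} \<subseteq> ?R \<or> {x. x i = v} \<subseteq> ?S"
      using i by (cases "i = q") auto
    then show "singular_simplex (q - 1) (subtopology ?C ?R) s \<or> singular_simplex (q - 1) (subtopology ?C ?S) s"
      using s singular_simplex_mono by blast
  qed
  \<comment> \<open>With \<open>y = x q\<close>, the new last coordinate is
    \<open>(1 + y) / 2\<close> at \<open>s = 1/2\<close>, whatever the sign of \<open>y\<close>, and
    \<open>max 0 y\<close> at \<open>s = 0\<close>. The first is the affine bijection, the second
    collapses the lower half. For \<open>\<bar>y\<bar> = 1\<close> the first summand vanishes, so
    the outer boundary stays in the boundary throughout.\<close>
  define H where "H = (\<lambda>(s::real, x). x(q := s * (1 - \<bar>x q\<bar>) + max 0 (x q)) :: nat \<Rightarrow> real)"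
  define T :: "real topology" where "T = top_of_set {0..1}"
  have H_cube: "H (s, x) \<in> cube q" if "s \<in> {0..1}" "x \<in> double_cube q" for s x
  proof -
    have "\<bar>x q\<bar> \<le> 1"
      using that by (auto simp: double_cube_def cube_def split: if_splits)
    then show ?thesis
      using that q double_cube_homotopy_bounds[of s "x q"]
      by (simp add: H_def double_cube_def fun_upd_in_cube_iff)
  qed
  have contx: "continuous_map (prod_topology T ?Q) euclideanreal (\<lambda>z. snd z i)" for i
    by (rule continuous_map_compose[OF continuous_map_snd, unfolded o_def])
      (intro continuous_map_from_subtopology continuous_map_product_projection, simp)
  have conts: "continuous_map (prod_topology T ?Q) euclideanreal fst"
    using continuous_map_fst unfolding T_def by (metis continuous_map_into_fulltopology)
  have "continuous_map (prod_topology T ?Q) (powertop_real UNIV) H"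
    unfolding continuous_map_componentwise_UNIV H_def
    by (auto simp: fun_upd_def case_prod_unfold intro!: contx conts continuous_map_add
        continuous_map_real_mult continuous_map_diff continuous_map_real_abs continuous_map_real_max)
  then have contH: "continuous_map (prod_topology T ?Q) ?C H"
    using H_cube by (auto simp: cube_topology_def continuous_map_in_subtopology T_def)
  \<comment> \<open>Time \<open>t\<close> of the homotopy is the parameter
    \<open>s = (1 - t) / 2\<close>, which falls from 1/2 to 0.\<close>
  have "homotopic_with (\<lambda>k. k \<in> double_cube_boundary q \<rightarrow> cube_boundary q) ?Q ?C
      (\<lambda>x. H (1/2, x)) (\<lambda>x. H (0, x))"
    unfolding homotopic_with_def
  proof (intro exI[of _ "\<lambda>(t, x). H ((1 - t) / 2, x)"] conjI ballI)
    have "continuous_map (prod_topology T ?Q) T (\<lambda>z. (1 - fst z) / 2)"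
      using conts unfolding T_def continuous_map_in_subtopology
      by (auto intro!: continuous_map_real_divide continuous_map_diff)
    then have "continuous_map (prod_topology T ?Q) (prod_topology T ?Q) (\<lambda>z. ((1 - fst z) / 2, snd z))"
      by (simp add: continuous_map_pairwise o_def continuous_map_snd)
    from continuous_map_compose[OF this contH]
    show "continuous_map (prod_topology (top_of_set {0..1}) ?Q) ?C (\<lambda>(t, x). H ((1 - t) / 2, x))"
      by (simp add: T_def o_def case_prod_unfold)
    show "(\<lambda>x. (\<lambda>(t, x). H ((1 - t) / 2, x)) (t, x)) \<in> double_cube_boundary q \<rightarrow> cube_boundary q"
      if "t \<in> {0..1}" for t
    proof
      fix x assume x: "x \<in> double_cube_boundary q"
      then have "H ((1 - t) / 2, x) \<in> cube q"
        using that by (intro H_cube) (auto simp: double_cube_boundary_def)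
      moreover have "H ((1 - t) / 2, x) q \<in> {0,1} \<or> (\<exists>i\<in>{1..<q}. H ((1 - t) / 2, x) i \<in> {0,1})"
        using x by (auto simp: double_cube_boundary_def H_def max_def)
      ultimately show "(\<lambda>(t, x). H ((1 - t) / 2, x)) (t, x) \<in> cube_boundary q"
        using q by (auto simp: cube_boundary_def)
    qed
  qed auto
  then have "homologous_rel q ?C (cube_boundary q) (chain_map q (\<lambda>x. H (1/2, x)) e) (chain_map q (\<lambda>x. H (0, x)) e)"
    using e by (rule homotopic_imp_homologous_rel_chain_maps)
  moreover have split: "chain_map q k e = chain_map q k (cube_chain q)
      - chain_map q (\<lambda>x. k (x(q := - x q))) (cube_chain q)" for k :: "_ \<Rightarrow> nat \<Rightarrow> real"
    using chain_map_compose[of q k "\<lambda>x. x(q := - x q)"] chain_map_ident[OF singular_chain_cube_chain]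
    by (simp add: e_def chain_map_diff o_def fun_eq_iff)
  have cm: "chain_map q k (cube_chain q) = chain_map q k' (cube_chain q)"
    if "\<And>x. x \<in> cube q \<Longrightarrow> k x = k' x" for k k' :: "_ \<Rightarrow> nat \<Rightarrow> real"
    using that by (intro chain_map_eq[OF singular_chain_cube_chain]) simp
  have "chain_map q (\<lambda>x. H (1/2, x)) e = chain_map q (\<lambda>x. x(q := (1 + x q) / 2)) (cube_chain q)
        - chain_map q (\<lambda>x. x(q := (1 - x q) / 2)) (cube_chain q)"
    unfolding split
    by (intro arg_cong2[of _ _ _ _ "(-)"] cm) (auto simp: H_def cube_def field_simps)
  moreover have "chain_map q (\<lambda>x. H (0, x)) e
      = cube_chain q - chain_map q (\<lambda>x. x(q := 0)) (cube_chain q)"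
  proof -
    have "chain_map q (\<lambda>x. H (0, x)) (cube_chain q) = cube_chain q"
      by (rule chain_map_id_gen[OF singular_chain_cube_chain]) (auto simp: H_def cube_def max_def)
    moreover have "chain_map q (\<lambda>x. H (0, x(q := - x q))) (cube_chain q)
        = chain_map q (\<lambda>x. x(q := 0)) (cube_chain q)"
      by (rule cm) (auto simp: H_def cube_def max_def fun_eq_iff intro: order_antisym)
    ultimately show ?thesis
      unfolding split by simp
  qed
  \<comment> \<open>The collapsed half lies in the facet \<open>x q = 0\<close>, hence does not
    change the class modulo the boundary.\<close>
  moreover have "homologous_rel q ?C (cube_boundary q)
      (cube_chain q - chain_map q (\<lambda>x. x(q := 0)) (cube_chain q)) (cube_chain q)"
  proof -
    have "continuous_map ?C (powertop_real UNIV) (\<lambda>x. x(q := 0))"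
      unfolding continuous_map_componentwise_UNIV
      by (auto simp: fun_upd_def intro!: continuous_map_cube_coordinate)
    then have "continuous_map ?C (subtopology ?C (cube_boundary q)) (\<lambda>x. x(q := 0))"
      using q by (auto simp: cube_topology_def continuous_map_in_subtopology cube_def cube_boundary_def)
    then have "singular_chain q (subtopology ?C (cube_boundary q)) (chain_map q (\<lambda>x. x(q := 0)) (cube_chain q))"
      by (rule singular_chain_chain_map[OF singular_chain_cube_chain])
    then have "singular_relboundary q ?C (cube_boundary q) (chain_map q (\<lambda>x. x(q := 0)) (cube_chain q))"
      by (rule singular_chain_imp_relboundary)
    then show ?thesis
      by (simp add: homologous_rel_def singular_relboundary_minus)
  qed
  ultimately show ?thesis
    by (metis homologous_rel_trans)
qed

section \<open>Joins of cubes, their homotopies and their chains\<close>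

text \<open>The halves are pasted along \<open>x q = 1/2\<close>, where both reparametrizations
  reach the facet \<open>x q = 0\<close>; there \<open>F\<close> and \<open>h \<circ> F\<close>
  agree by \<open>fixed\<close>. The parameter in \<open>T\<close> is carried along so that a
  homotopy of cubes yields a homotopy of joins.\<close>

lemma continuous_map_cube_join:
  assumes q: "q \<ge> 1" and h: "continuous_map A A h"
    and F: "continuous_map (prod_topology T (cube_topology q)) A F"
    and fixed: "\<And>t x. \<lbrakk>t \<in> topspace T; x \<in> cube q; x q = 0\<rbrakk> \<Longrightarrow> h (F (t, x)) = F (t, x)"
  shows "continuous_map (prod_topology T (cube_topology q)) A
    (\<lambda>(t, x). cube_join q (\<lambda>x. F (t, x)) (h \<circ> (\<lambda>x. F (t, x))) x)"
proof -
  let ?P = "prod_topology T (cube_topology q)"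
  let ?l = "\<lambda>z. (fst z, (snd z)(q := 1 - 2 * snd z q))" and ?r = "\<lambda>z. (fst z, (snd z)(q := 2 * snd z q - 1))"
  let ?L = "subtopology ?P {z \<in> topspace ?P. snd z q \<le> 1/2}"
    and ?R = "subtopology ?P {z \<in> topspace ?P. 1/2 \<le> snd z q}"
  have coord: "continuous_map ?P euclideanreal (\<lambda>z. snd z i)" for i
    using continuous_map_compose[OF continuous_map_snd continuous_map_cube_coordinate]
    by (simp add: o_def)
  have cube: "x(q := y) \<in> cube q" if "x \<in> cube q" "0 \<le> y" "y \<le> 1" for x y
    using that q by (auto simp: fun_upd_in_cube_iff) (auto simp: cube_def)
  have upd: "continuous_map ?P (prod_topology T (powertop_real UNIV)) ?l"
    "continuous_map ?P (prod_topology T (powertop_real UNIV)) ?r"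
    unfolding continuous_map_pairwise o_def continuous_map_componentwise_UNIV
    by (auto simp: fun_upd_def continuous_map_fst
        intro!: coord continuous_map_diff continuous_map_real_mult)
  have "continuous_map ?L ?P ?l" "continuous_map ?R ?P ?r"
    using upd unfolding continuous_map_pairwise o_def cube_topology_def continuous_map_in_subtopology
    by (auto simp: continuous_map_from_subtopology cube_def[symmetric] intro!: cube)
       (auto simp: cube_def)
  then have cont: "continuous_map ?L A (\<lambda>z. F (?l z))" "continuous_map ?R A (\<lambda>z. h (F (?r z)))"
    using continuous_map_compose[of _ ?P _ A F] continuous_map_compose[OF F h]
      continuous_map_compose[of _ ?P _ A "h \<circ> F"] F by (auto simp: o_def)
  have "continuous_map ?P A (\<lambda>z. if snd z q \<le> 1/2 then F (?l z) else h (F (?r z)))"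
  proof (rule continuous_map_cases_le[OF coord])
    fix z assume z: "z \<in> topspace ?P" "snd z q = 1/2"
    then have "fst z \<in> topspace T" "(snd z)(q := 0) \<in> cube q"
      using cube by auto
    then show "F (?l z) = h (F (?r z))"
      using fixed[of "fst z" "(snd z)(q := 0)"] unfolding z(2) by simp
  qed (use cont in auto)
  then show ?thesis
    by (simp add: cube_join_def case_prod_unfold o_def)
qed

text \<open>The join is formed at every time of the homotopy. This makes the homotopical variation
  independent of the representative, and the constant homotopy shows that a join is an absolute
  cube.\<close>

lemma homotopic_with_cube_join:
  assumes q: "q \<ge> 1" and h: "continuous_map A A h" and fixed: "\<And>x. x \<in> B \<Longrightarrow> h x = x"
    and b: "b \<in> B"
    and ff': "homotopic_with (\<lambda>k. k \<in> rel_cubes q A B b) (cube_topology q) A f f'"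
  shows "homotopic_with (\<lambda>k. k \<in> abs_cubes q A b) (cube_topology q) A
    (cube_join q f (h \<circ> f)) (cube_join q f' (h \<circ> f'))"
proof -
  obtain F where F: "continuous_map (prod_topology (top_of_set {0..1::real}) (cube_topology q)) A F"
    and F01: "\<forall>x. F (0, x) = f x" "\<forall>x. F (1, x) = f' x"
    and "\<forall>t\<in>{0..1}. (\<lambda>x. F (t, x)) \<in> rel_cubes q A B b"
    using ff' unfolding homotopic_with_def by blast
  then have Fr: "(\<lambda>x. F (t, x)) \<in> rel_cubes q A B b" if "t \<in> {0..1}" for t
    using that by blast
  let ?G = "\<lambda>(t, x). cube_join q (\<lambda>x. F (t, x)) (h \<circ> (\<lambda>x. F (t, x))) x"
  have G: "continuous_map (prod_topology (top_of_set {0..1}) (cube_topology q)) A ?G"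
    using Fr by (intro continuous_map_cube_join[OF q h F]) (auto simp: rel_cubes_def fixed)
  show ?thesis
    unfolding homotopic_with_def
  proof (intro exI[of _ ?G] conjI ballI allI G)
    fix t :: real assume t: "t \<in> {0..1}"
    let ?f = "\<lambda>x. F (t, x)"
    have "continuous_map (cube_topology q) A (\<lambda>x. ?G (t, x))"
      using continuous_map_compose[OF _ G, of "cube_topology q" "\<lambda>x. (t, x)"] t
      by (simp add: continuous_map_pairwise o_def)
    \<comment> \<open>At \<open>x q = 0\<close> and at \<open>x q = 1\<close> the argument of
      \<open>?f\<close> has last coordinate 1, so \<open>?f\<close> takes the value \<open>b\<close>
      there; in the upper half \<open>h\<close> is applied as well, and
      \<open>h b = b\<close>.\<close>
    moreover have "cube_join q ?f (h \<circ> ?f) x = b" if x: "x \<in> cube_boundary q" for x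
    proof -
      have f: "?f y = b" if "y \<in> cube q" "y q = 1 \<or> (\<exists>i\<in>{1..<q}. y i = 0 \<or> y i = 1)" for y
        using that Fr[OF t] by (auto simp: rel_cubes_def)
      have "x(q := 1 - 2 * x q) \<in> cube q" if "x q \<le> 1/2"
        using that x q by (auto simp: cube_boundary_def fun_upd_in_cube_iff) (auto simp: cube_def)
      moreover have "x(q := 2 * x q - 1) \<in> cube q" if "\<not> x q \<le> 1/2"
        using that x q by (auto simp: cube_boundary_def fun_upd_in_cube_iff) (auto simp: cube_def)
      moreover have "x q = 0 \<or> x q = 1 \<or> (\<exists>i\<in>{1..<q}. x i = 0 \<or> x i = 1)"
        using x by (force simp: cube_boundary_def)
      ultimately show ?thesis
        using f[of "x(q := 1 - 2 * x q)"] f[of "x(q := 2 * x q - 1)"] fixed[OF b]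
        by (fastforce simp: cube_join_def)
    qed
    ultimately show "(\<lambda>x. ?G (t, x)) \<in> abs_cubes q A b"
      by (simp add: abs_cubes_def)
  qed (auto simp: F01)
qed

text \<open>Composed with the parametrizations of the upper and lower half, the join becomes
  \<open>h \<circ> f\<close> and \<open>f\<close>. Pushing the decomposition of the cube forward
  along the join, which sends the boundary to \<open>b\<close>, gives the relation modulo
  \<open>b\<close>.\<close>

lemma cube_join_homologous:
  assumes q: "q \<ge> 1" and f: "f \<in> rel_cubes q A B b"
    and fixed: "\<And>x. x \<in> B \<Longrightarrow> h x = x" and j: "cube_join q f (h \<circ> f) \<in> abs_cubes q A b"
  shows "homologous_rel q A {b}
     (chain_map q h (chain_map q f (cube_chain q)) - chain_map q f (cube_chain q))
     (chain_map q (cube_join q f (h \<circ> f)) (cube_chain q))"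
proof -
  let ?j = "cube_join q f (h \<circ> f)" and ?c = "cube_chain q"
  let ?u = "\<lambda>x. x(q := (1 + x q) / 2)" and ?l = "\<lambda>x. x(q := (1 - x q) / 2)"
  have "homologous_rel q A {b} (chain_map q ?j (chain_map q ?u ?c - chain_map q ?l ?c)) (chain_map q ?j ?c)"
    using singular_relboundary_chain_map[OF homologous_rel_two_halves[OF q, unfolded homologous_rel_def], of A ?j "{b}"] j
    by (simp add: homologous_rel_def chain_map_diff abs_cubes_def)
  moreover have "chain_map q ?j (chain_map q ?u ?c) = chain_map q h (chain_map q f ?c)"
  proof -
    have "(?j \<circ> ?u) x = (h \<circ> f) x" if x: "x \<in> cube q" for x
    \<comment> \<open>For \<open>x q = 0\<close> the last coordinate of \<open>?u x\<close> is
      exactly 1/2, where the join takes its first branch and gives \<open>f x\<close> without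
      \<open>h\<close>; this is harmless because \<open>f x\<close> lies in
      \<open>B\<close>.\<close>
    proof (cases "x q = 0")
      case True
      then show ?thesis
        using x f by (auto simp: cube_join_def rel_cubes_def fixed fun_upd_idem)
    next
      case False
      then have "x q > 0"
        using x by (auto simp: cube_def order_less_le)
      then have "\<not> (1 + x q) / 2 \<le> 1/2"
        by simp
      moreover have "2 * ((1 + x q) / 2) - 1 = x q"
        by (simp add: field_simps)
      ultimately show ?thesis
        by (simp only: cube_join_def o_def fun_upd_same fun_upd_upd if_False fun_upd_triv)
    qed
    then have "chain_map q (?j \<circ> ?u) ?c = chain_map q (h \<circ> f) ?c"
      by (intro chain_map_eq[OF singular_chain_cube_chain]) simp
    then show ?thesis
      by (simp add: chain_map_compose)
  qed
  moreover have "chain_map q ?j (chain_map q ?l ?c) = chain_map q f ?c"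
  proof -
    have "1 - 2 * ((1 - y) / 2) = y" for y :: real
      by (simp add: field_simps)
    then have "(?j \<circ> ?l) x = f x" if "x \<in> cube q" for x
      using that by (auto simp: cube_join_def cube_def)
    then have "chain_map q (?j \<circ> ?l) ?c = chain_map q f ?c"
      by (intro chain_map_eq[OF singular_chain_cube_chain]) simp
    then show ?thesis
      by (simp add: chain_map_compose)
  qed
  ultimately show ?thesis
    by (simp add: chain_map_diff)
qed

section \<open>Variation and Hurewicz maps on representatives\<close>

text \<open>The part \<open>e\<close> of \<open>c - c'\<close> carried by the point is itself a
  cycle, and cycles of positive dimension in a point are boundaries. In other words,
  \<open>H_p(X) -> H_p(X, b)\<close> is injective.\<close>

lemma homologous_rel_point_imp_homologous:
  assumes p: "p \<ge> 1" and b: "b \<in> topspace X"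
    and c: "singular_relcycle p X {} c" "singular_relcycle p X {} c'" "homologous_rel p X {b} c c'"
  shows "homologous_rel p X {} c c'"
proof -
  obtain d e where d: "singular_chain (Suc p) X d" and e: "singular_chain p (subtopology X {b}) e"
    and cde: "chain_boundary (Suc p) d + e = c - c'"
    using c(3) unfolding homologous_rel_def singular_relboundary by blast
  have "e = (c - c') - chain_boundary (Suc p) d"
    by (simp flip: cde)
  then have "chain_boundary p e = chain_boundary p c - chain_boundary p c'
      - chain_boundary p (chain_boundary (Suc p) d)"
    by (simp only: chain_boundary_diff)
  then have "chain_boundary p e = 0"
    using c(1,2) chain_boundary_boundary_alt[OF d] by (simp add: singular_cycle)
  then have "singular_relcycle p (subtopology X {b}) {} e"
    using e by (simp add: singular_cycle)
  moreover have "topspace (subtopology X {b}) = {b}"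
    using b by auto
  ultimately have "singular_relboundary p (subtopology X {b}) {} e"
    using p singular_boundary_eq_cycle_singleton by metis
  then have "singular_relboundary p X {} e"
    unfolding singular_boundary singular_chain_subtopology by blast
  moreover have "singular_relboundary p X {} (chain_boundary (Suc p) d)"
    using d unfolding singular_boundary by blast
  ultimately show ?thesis
    unfolding homologous_rel_def cde[symmetric] by (intro singular_relboundary_add)
qed

text \<open>The boundary of \<open>z\<close> lies in \<open>B\<close>, where \<open>h\<close> is the
  identity, so it cancels in the difference.\<close>

lemma singular_cycle_variation:
  assumes z: "singular_relcycle p X B z" and h: "continuous_map X X h"
    and fixed: "\<And>x. x \<in> B \<Longrightarrow> h x = x"
  shows "singular_relcycle p X {} (chain_map p h z - z)"
proof -
  have zX: "singular_chain p X z"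
    using z by (simp add: singular_relcycle)
  have "chain_map (p - 1) h (chain_boundary p z) = chain_boundary p z"
    using z fixed by (intro chain_map_id_gen[of "p - 1" "subtopology X B"]) (auto simp: singular_relcycle)
  then show ?thesis
    using zX h by (simp add: singular_cycle chain_boundary_diff chain_boundary_chain_map[OF zX]
        singular_chain_diff singular_chain_chain_map)
qed

text \<open>If \<open>z - z'\<close> is the boundary of \<open>d\<close> plus a chain
  \<open>e\<close> in \<open>B\<close>, then \<open>h\<close> fixes \<open>e\<close>. Thus
  \<open>e\<close> drops out, and the two variations differ by the boundary of
  \<open>h d - d\<close>.\<close>

lemma homologous_rel_variation:
  assumes zz': "homologous_rel p X B z z'" and h: "continuous_map X X h"
    and fixed: "\<And>x. x \<in> B \<Longrightarrow> h x = x"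
  shows "homologous_rel p X {} (chain_map p h z - z) (chain_map p h z' - z')"
proof -
  obtain d e where d: "singular_chain (Suc p) X d" and e: "singular_chain p (subtopology X B) e"
    and zde: "chain_boundary (Suc p) d + e = z - z'"
    using zz' unfolding homologous_rel_def singular_relboundary by blast
  have "chain_map p h e = e"
    using fixed by (intro chain_map_id_gen[OF e]) auto
  then have "chain_map p h z - chain_map p h z' = chain_boundary (Suc p) (chain_map (Suc p) h d) + e"
    unfolding chain_map_diff[symmetric] zde[symmetric] by (simp add: chain_map_add chain_boundary_chain_map[OF d])
  then have "(chain_map p h z - z) - (chain_map p h z' - z')
      = chain_boundary (Suc p) (chain_map (Suc p) h d) + e - (chain_boundary (Suc p) d + e)"
    unfolding zde by simp
  also have "\<dots> = chain_boundary (Suc p) (chain_map (Suc p) h d - d)"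
    by (simp add: chain_boundary_diff)
  finally show ?thesis
    unfolding homologous_rel_def singular_boundary
    using d h by (intro exI[of _ "chain_map (Suc p) h d - d"])
      (simp add: singular_chain_diff singular_chain_chain_map)
qed

lemma homological_variation_class:
  assumes "continuous_map X X h" "\<And>x. x \<in> B \<Longrightarrow> h x = x"
  shows "homological_variation p X h (homologous_rel_set p X B z)
    = homologous_rel_set p X {} (chain_map p h z - z)"
  unfolding homological_variation_def
proof (rule the_elem_image_unique)
  fix z' assume "z' \<in> homologous_rel_set p X B z"
  then have "homologous_rel p X {} (chain_map p h z - z) (chain_map p h z' - z')"
    using assms by (intro homologous_rel_variation) auto
  then show "homologous_rel_set p X {} (chain_map p h z' - z')
      = homologous_rel_set p X {} (chain_map p h z - z)"
    unfolding homologous_rel_set_eq by (subst homologous_rel_sym)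
qed (auto intro: homologous_rel_refl)

text \<open>Homotopic maps of pairs send the relative cycle of the cube to homologous chains. The
  set \<open>F\<close> is kept general to serve both \<open>rel_cubes\<close> and, with
  \<open>B = {b}\<close>, \<open>abs_cubes\<close>.\<close>

lemma rel_hurewicz_class:
  assumes q: "q \<ge> 1" and f: "f \<in> F"
    and F: "\<And>k. k \<in> F \<Longrightarrow> continuous_map (cube_topology q) A k \<and> k \<in> cube_boundary q \<rightarrow> B"
  shows "rel_hurewicz q A B (cube_homotopy q A F `` {f}) = homologous_rel_set q A B (chain_map q f (cube_chain q))"
proof -
  have hom: "hom_induced (int q) (cube_topology q) (cube_boundary q) A B k (cube_class q)
      = homologous_rel_set q A B (chain_map q f (cube_chain q))"
    if "k \<in> cube_homotopy q A F `` {f}" for k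
  proof -
    have fk: "homotopic_with (\<lambda>k. k \<in> F) (cube_topology q) A f k"
      using that by (simp add: cube_homotopy_def)
    then have "k \<in> F"
      using homotopic_with_imp_property[OF fk] by simp
    have "homotopic_with (\<lambda>k. k \<in> cube_boundary q \<rightarrow> B) (cube_topology q) A f k"
      using fk by (rule homotopic_with_mono) (use F in blast)
    then have "homologous_rel q A B (chain_map q f (cube_chain q)) (chain_map q k (cube_chain q))"
      by (rule homotopic_imp_homologous_rel_chain_maps[OF _ singular_relcycle_cube_chain[OF q]])
    then have "homologous_rel_set q A B (chain_map q k (cube_chain q))
        = homologous_rel_set q A B (chain_map q f (cube_chain q))"
      by (simp only: homologous_rel_set_eq homologous_rel_sym)
    then show ?thesis
      unfolding cube_class_def using F[OF \<open>k \<in> F\<close>]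
      by (simp only: hom_induced_chain_map[OF _ _ singular_relcycle_cube_chain[OF q]])
  qed
  have f': "f \<in> cube_homotopy q A F `` {f}"
    using F f by (simp add: cube_homotopy_def)
  show ?thesis
    unfolding rel_hurewicz_def
    unfolding hom[OF f', symmetric] by (rule the_elem_image_unique) (use f' hom in auto)
qed

text \<open>By injectivity of \<open>H_q(A) -> H_q(A, b)\<close>, \<open>inv_into\<close> returns
  the class of any absolute cycle \<open>z\<close> with the right image. This leaves the choice of
  \<open>z\<close> free; later it is a variation \<open>h z - z\<close>.\<close>

lemma abs_hurewicz_class:
  assumes q: "q \<ge> 1" and f: "f \<in> abs_cubes q A b" and b: "b \<in> topspace A"
    and z: "singular_relcycle q A {} z" "homologous_rel q A {b} z (chain_map q f (cube_chain q))"
  shows "abs_hurewicz q A b (cube_homotopy q A (abs_cubes q A b) `` {f}) = homologous_rel_set q A {} z"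
proof -
  let ?i = "hom_induced (int q) A {} A {b} id"
  have i: "?i (homologous_rel_set q A {} c) = homologous_rel_set q A {b} c"
    if "singular_relcycle q A {} c" for c
    using that by (simp add: hom_induced_chain_map chain_map_ident[of q A] singular_relcycle)
  have inj: "inj_on ?i (carrier (homology_group (int q) A))"
    using homologous_rel_point_imp_homologous[OF q b]
    by (auto simp: inj_on_def carrier_relative_homology_group i homologous_rel_set_eq)
  have "rel_hurewicz q A {b} (cube_homotopy q A (abs_cubes q A b) `` {f})
      = homologous_rel_set q A {b} (chain_map q f (cube_chain q))"
    by (rule rel_hurewicz_class[OF q f]) (auto simp: abs_cubes_def)
  also have "\<dots> = ?i (homologous_rel_set q A {} z)"
    unfolding i[OF z(1)] homologous_rel_set_eq using z(2) by (subst homologous_rel_sym)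
  finally show ?thesis
    unfolding abs_hurewicz_def
    using z(1) by (simp only:) (rule inv_into_f_f[OF inj], simp add: carrier_relative_homology_group)
qed

lemma cube_homotopy_class_eq:
  assumes fg: "homotopic_with (\<lambda>k. k \<in> F) (cube_topology q) A f g"
  shows "cube_homotopy q A F `` {f} = cube_homotopy q A F `` {g}"
proof -
  have "homotopic_with (\<lambda>k. k \<in> F) (cube_topology q) A f k
      \<longleftrightarrow> homotopic_with (\<lambda>k. k \<in> F) (cube_topology q) A g k" for k
    using homotopic_with_trans[OF fg] homotopic_with_trans[OF homotopic_with_symD[OF fg]] by blast
  then show ?thesis
    by (simp add: cube_homotopy_def Image_singleton)
qed

lemma homotopical_variation_class:
  assumes q: "q \<ge> 1" and h: "continuous_map A A h" and fixed: "\<And>x. x \<in> B \<Longrightarrow> h x = x"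
    and b: "b \<in> B" and f: "f \<in> rel_cubes q A B b"
  shows "homotopical_variation q A b h (cube_homotopy q A (rel_cubes q A B b) `` {f})
    = cube_homotopy q A (abs_cubes q A b) `` {cube_join q f (h \<circ> f)}"
  unfolding homotopical_variation_def
proof (rule the_elem_image_unique)
  show "cube_homotopy q A (rel_cubes q A B b) `` {f} \<noteq> {}"
    using f by (auto simp: cube_homotopy_def rel_cubes_def intro!: exI[of _ f])
  fix k assume "k \<in> cube_homotopy q A (rel_cubes q A B b) `` {f}"
  then have "homotopic_with (\<lambda>k. k \<in> rel_cubes q A B b) (cube_topology q) A f k"
    by (simp add: cube_homotopy_def)
  from cube_homotopy_class_eq[OF homotopic_with_cube_join[OF q h fixed b this]]
  show "cube_homotopy q A (abs_cubes q A b) `` {cube_join q k (h \<circ> k)}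
      = cube_homotopy q A (abs_cubes q A b) `` {cube_join q f (h \<circ> f)}"
    by simp
qed

text \<open>Both sides are the absolute class of \<open>h z - z\<close>, with \<open>z\<close> the
  image of the cube under \<open>f\<close>: the right one by evaluation on representatives, the left
  one because this cycle is homologous to the join modulo \<open>b\<close>.\<close>

lemma hurewicz_variation:
  assumes q: "q \<ge> 1" and h: "continuous_map A A h" and fixed: "\<And>x. x \<in> B \<Longrightarrow> h x = x"
    and b: "b \<in> B" "b \<in> topspace A" and c: "c \<in> rel_homotopy_set q A B b"
  shows "abs_hurewicz q A b (homotopical_variation q A b h c) = homological_variation q A h (rel_hurewicz q A B c)"
proof -
  obtain f where f: "f \<in> rel_cubes q A B b" and c: "c = cube_homotopy q A (rel_cubes q A B b) `` {f}"
    using c unfolding rel_homotopy_set_def by (rule quotientE)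
  have F: "continuous_map (cube_topology q) A k \<and> k \<in> cube_boundary q \<rightarrow> B" if "k \<in> rel_cubes q A B b" for k
  proof -
    have "k x \<in> B" if x: "x \<in> cube_boundary q" for x
    proof -
      obtain i where i: "i \<in> {1..q}" "x i = 0 \<or> x i = 1" and x: "x \<in> cube q"
        using x by (auto simp: cube_boundary_def)
      consider "x q = 0" | "x q = 1" | "i \<in> {1..<q}"
        using i by (cases "i = q") auto
      then show ?thesis
        using \<open>k \<in> rel_cubes q A B b\<close> i x b(1) by cases (auto simp: rel_cubes_def)
    qed
    then show ?thesis
      using \<open>k \<in> rel_cubes q A B b\<close> by (auto simp: rel_cubes_def)
  qed
  let ?j = "cube_join q f (h \<circ> f)" and ?z = "chain_map q f (cube_chain q)"
  \<comment> \<open>Reflexivity of the homotopy relation for the join amounts to its being an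
    absolute cube.\<close>
  have "homotopic_with (\<lambda>k. k \<in> abs_cubes q A b) (cube_topology q) A ?j ?j"
    using F[OF f] f by (intro homotopic_with_cube_join[OF q h fixed b(1)]) auto
  then have j: "?j \<in> abs_cubes q A b"
    by simp
  have "singular_relcycle q A B ?z"
    using F[OF f] by (intro singular_relcycle_chain_map[OF singular_relcycle_cube_chain[OF q]]) auto
  then have "singular_relcycle q A {} (chain_map q h ?z - ?z)"
    using h fixed by (rule singular_cycle_variation)
  then have "abs_hurewicz q A b (cube_homotopy q A (abs_cubes q A b) `` {?j})
      = homologous_rel_set q A {} (chain_map q h ?z - ?z)"
    using cube_join_homologous[OF q f fixed j] by (rule abs_hurewicz_class[OF q j b(2)])
  also have "\<dots> = homological_variation q A h (rel_hurewicz q A B c)"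
  proof -
    have "rel_hurewicz q A B c = homologous_rel_set q A B ?z"
      unfolding c using q f F by (rule rel_hurewicz_class)
    then show ?thesis
      using homological_variation_class[OF h fixed] by simp
  qed
  finally show ?thesis
    using homotopical_variation_class[OF q h fixed b(1) f] c by simp
qed

section \<open>The pencil and its monodromy\<close>

text \<open>The equation of each member is a linear combination of the two equations of the
  axis.\<close>

lemma pencil_axis_subset_member: "pencil_axis a b \<subseteq> pencil_member a b \<mu>"
proof
  fix p assume p: "p \<in> pencil_axis a b"
  have "(\<Sum>i\<in>UNIV. (s *s a + t *s b) $ i * v $ i) = 0" if "v \<in> Rep_cproj p" for s t v
  proof -
    have "(\<Sum>i\<in>UNIV. (s *s a + t *s b) $ i * v $ i)
        = s * (\<Sum>i\<in>UNIV. a $ i * v $ i) + t * (\<Sum>i\<in>UNIV. b $ i * v $ i)"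
      by (simp add: sum_distrib_left sum.distrib algebra_simps)
    then show ?thesis
      using p that by (simp add: pencil_axis_def hyperplane_of_def)
  qed
  then show "p \<in> pencil_member a b \<mu>"
    by (simp add: pencil_member_def hyperplane_of_def)
qed

text \<open>At time 1 the member over the loop is \<open>L\<close> again, so the final homeomorphism
  is a self-map. The inclusion of \<open>M\<close> in \<open>L\<close> enters because
  \<open>h\<close> is prescribed on \<open>L \<inter> X\<close> only.\<close>

lemma geometric_monodromy_relative:
  assumes h: "geometric_monodromy P X L M K \<omega> h" and \<omega>: "P (\<omega> 1) = L" and M: "M \<subseteq> L"
  shows "continuous_map (top_of_set (L \<inter> X)) (top_of_set (L \<inter> X)) h" "\<And>x. x \<in> M \<inter> X \<Longrightarrow> h x = x"
proof -
  obtain \<Theta> :: "_ \<times> real \<Rightarrow> _" where "\<forall>t\<in>{0..1}.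
      homeomorphic_map (top_of_set (L \<inter> X)) (top_of_set (X \<inter> P (\<omega> t))) (\<lambda>x. \<Theta> (x, t))"
    and "\<forall>t\<in>{0..1}. \<forall>x\<in>M \<inter> X. \<Theta> (x, t) = x" and h: "\<forall>x\<in>L \<inter> X. h x = \<Theta> (x, 1)"
    using h unfolding geometric_monodromy_def by blast
  then have hom: "homeomorphic_map (top_of_set (L \<inter> X)) (top_of_set (X \<inter> P (\<omega> 1))) (\<lambda>x. \<Theta> (x, 1))"
    and fixed: "\<forall>x\<in>M \<inter> X. \<Theta> (x, 1) = x"
    by auto
  have "continuous_map (top_of_set (L \<inter> X)) (top_of_set (L \<inter> X)) (\<lambda>x. \<Theta> (x, 1))"
    using homeomorphic_imp_continuous_map[OF hom] \<omega> by (simp add: Int_commute)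
  then show "continuous_map (top_of_set (L \<inter> X)) (top_of_set (L \<inter> X)) h"
    by (rule continuous_map_eq) (simp add: h)
  show "h x = x" if "x \<in> M \<inter> X" for x
    using that M h fixed by auto
qed

theorem lemma4p3:
  fixes X Y Z L M :: "'n::finite cproj set"
    and \<S> :: "'n cproj set set"
    and a b :: "complex ^ 'n"
    and l :: "2 cproj"
    and I :: "'i set"
    and lam :: "'i \<Rightarrow> 2 cproj"
    and D :: "'i \<Rightarrow> 2 cproj set"
    and g :: "'i \<Rightarrow> real \<Rightarrow> 2 cproj"
    and \<omega> :: "real \<Rightarrow> 2 cproj"
    and h :: "'n cproj \<Rightarrow> 'n cproj"
    and A :: "'n cproj topology"
    and pt :: "'n cproj"
    and i :: 'i
    and q :: nat
  assumes dim: "CARD('n) \<ge> 3"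
    and variety: "closed_algebraic Y" "Y \<noteq> {}" "closed_algebraic Z" "Z \<subset> Y" "X = Y - Z"
    and strat: "whitney_stratification \<S> Y" "\<exists>\<T>\<subseteq>\<S>. Z = \<Union>\<T>"
    and hyperplane: "proj_hyperplane L" "transverse_to L \<S>"
    and pencil: "is_pencil a b" "L = pencil_member a b l" "M = pencil_axis a b" "transverse_to M \<S>"
    and exceptional: "finite I" "inj_on lam I" "l \<notin> lam ` I"
      "\<And>\<mu>. \<mu> \<notin> lam ` I \<Longrightarrow> transverse_to (pencil_member a b \<mu>) \<S>"
    and system: "arc_disk_system l I lam D g"
    and index: "i \<in> I"
    and loop: "lasso_loop (g i) (D i) (lam i) \<omega>"
    and monodromy: "geometric_monodromy (pencil_member a b) X L M (path_image (g i) \<union> D i) \<omega> h"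
    and space: "A = top_of_set (L \<inter> X)"
    and base: "pt \<in> M \<inter> X"
    and q: "q \<ge> 1"
  shows "\<forall>c \<in> rel_homotopy_set q A (M \<inter> X) pt.
           (abs_hurewicz q A pt \<circ> homotopical_variation q A pt h) c =
           (homological_variation q A h \<circ> rel_hurewicz q A (M \<inter> X)) c"
proof
  fix c assume c: "c \<in> rel_homotopy_set q A (M \<inter> X) pt"
  \<comment> \<open>The last piece of the loop is the arc \<open>g i\<close> run backwards, which
    ends at its starting point \<open>l\<close>.\<close>
  have "\<omega> 1 = l"
    using loop system index
    by (auto simp: lasso_loop_def arc_disk_system_def joinpaths_def reversepath_def pathstart_def)
  then have member_L: "pencil_member a b (\<omega> 1) = L"
    by (simp add: pencil(2))
  have axis_L: "M \<subseteq> L"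
    unfolding pencil(2,3) by (rule pencil_axis_subset_member)
  note h = geometric_monodromy_relative[OF monodromy member_L axis_L]
  have "continuous_map A A h" "pt \<in> topspace A"
    using h(1) base axis_L by (auto simp: space)
  then show "(abs_hurewicz q A pt \<circ> homotopical_variation q A pt h) c =
      (homological_variation q A h \<circ> rel_hurewicz q A (M \<inter> X)) c"
    using hurewicz_variation[OF q _ h(2) base _ c] by simp
qed

end
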